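(* Let $X$ be a cubical set, let $I$ and $J$ be disjoint finite sets of symbols, let $y\notin I\cup J$ be a symbol, and let $\varepsilon\in\{+,-\}$ be a polarity. The functions $$\mathsf{nrv}^{\varepsilon}:\mathrm{Hom}\bigl(\mathrm{Box}^{\varepsilon}(I;J;y),X\bigr)\to\mathrm{AlgBox}^{\varepsilon}_X(I;J;y),\qquad \mathsf{rlz}^{\varepsilon}:\mathrm{AlgBox}^{\varepsilon}_X(I;J;y)\to\mathrm{Hom}\bigl(\mathrm{Box}^{\varepsilon}(I;J;y),X\bigr)$$ are inverse to each other.
   Context: Cube category: fix an infinite supply of symbols (names). The category $\mathcal{C}$ has as objects finite sets of symbols; a morphism $f:I\to J$ is a function $f:I\to J\sqcup\{\mathbf 0,\mathbf 1\}$ that is injective on the preimage of $J$. Identities are the evident inclusions, and $(g\circ f)(x)=g(f(x))$ if $f(x)\in J$, $(g\circ f)(x)=f(x)$ if $f(x)\in\{\mathbf 0,\mathbf 1\}$. A cubical set is a (covariant) functor $X:\mathcal{C}\to\mathbf{Set}$, written $I\mapsto X_I$, $f\mapsto X_f$; morphisms of cubical sets are natural transformations, and $\mathrm{Hom}$ between cubical sets denotes the set of these. The free-standing $L$-cube is $\square^{L}:=\mathrm{Hom}_{\mathcal{C}}(L,-)$. Face maps: for a symbol $i$ and $b\in\{\mathbf 0,\mathbf 1\}$, the polymorphic face map $(i\mapsto b)$ denotes, for every finite set $L$ with $i\notin L$, the morphism $L\cup\{i\}\to L$ sending $i$ to $b$ and fixing every element of $L$. For $I$, $y$ and polarity $\varepsilon$,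 put $s_{+}=\mathbf 0$, $s_{-}=\mathbf 1$ and $$\Omega^{\varepsilon}_{I,y}:=\{(i\mapsto b): i\in I,\ b\in\{\mathbf 0,\mathbf 1\}\}\cup\{(y\mapsto s_\varepsilon)\}.$$ For $f=(i\mapsto b)\in\Omega^{\varepsilon}_{I,y}$, its $J$-instance is the morphism $f_J:I\cup J\cup\{y\}\to K_f\cup J$ with $K_f=(I\cup\{y\})\setminus\{i\}$. Two face maps $f_1=(i_1\mapsto b_1)$, $f_2=(i_2\mapsto b_2)$ are orthogonal if $f_1\circ f_2=f_2\circ f_1$ for appropriate (composable) instances starting at $I\cup J\cup\{y\}$, i.e. $i_1\ne i_2$. Free-standing box of polarity $\varepsilon$ ($+$ positive, $-$ negative): the subfunctor $\mathrm{Box}^{\varepsilon}(I;J;y)\subseteq\square^{I\cup J\cup\{y\}}$ given by $$\mathrm{Box}^{\varepsilon}(I;J;y)_K=\{f:I\cup J\cup\{y\}\to K \mid f=h\circ g_J\text{ for some }g\in\Omega^{\varepsilon}_{I,y}\text{ and some morphism }h\},$$ acting on morphisms by post-composition. A geometric box in $X$ is a morphism $\mathrm{Box}^{\varepsilon}(I;J;y)\to X$. $\mathrm{AlgBox}^{\varepsilon}_X(I;J;y)$ is the set of algebraic boxes of polarity $\varepsilon$ in $X$: families $\boldsymbol\beta=\{\boldsymbol\beta_f\}_{f\in\Omega^{\varepsilon}_{I,y}}$ with $\boldsymbol\beta_f\in X_{\mathrm{cod}(f_J)}$ satisfying the adjacency condition $X_{f_2}(\boldsymbol\beta_{f_1})=X_{f_1}(\boldsymbol\beta_{f_2})$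 for all orthogonal $f_1,f_2\in\Omega^{\varepsilon}_{I,y}$ (where $f_2$ in $X_{f_2}(\boldsymbol\beta_{f_1})$ denotes its instance with domain $\mathrm{cod}((f_1)_J)$, and similarly with indices exchanged). Nerve: $\mathsf{nrv}^{\varepsilon}(\beta)_f:=\beta_{\mathrm{cod}(f_J)}(f_J)$ for $f\in\Omega^{\varepsilon}_{I,y}$. Realization: for $f\in\mathrm{Box}^{\varepsilon}(I;J;y)_K$, choose any factorization $f=f_2\circ(f_1)_J$ with $f_1\in\Omega^{\varepsilon}_{I,y}$ and put $(\mathsf{rlz}^{\varepsilon}(\boldsymbol\beta))_K(f):=X_{f_2}(\boldsymbol\beta_{f_1})$. (Both are well-defined functions with the indicated domains and codomains; in particular the latter is independent of the factorization.) *)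

theory Defs
  imports "HOL-Library.FuncSet"
begin

datatype endpoint = Zero | One

text \<open>
  Symbols are the elements of a type \<open>'a\<close>, and the objects are the finite sets of symbols.
  The disjoint union of \<open>J\<close> with the two endpoints is \<open>J <+> UNIV\<close>. Morphisms are extensional
  functions (undefined off their domain), so that equality of morphisms is equality in HOL.
  A function does not determine its codomain, so the codomain is passed explicitly where it matters.
\<close>

type_synonym 'a cmap = "'a \<Rightarrow> 'a + endpoint"

definition cmor :: "'a set \<Rightarrow> 'a set \<Rightarrow> 'a cmap set" where
  "cmor I J = {f \<in> I \<rightarrow>\<^sub>E (J <+> (UNIV :: endpoint set)). inj_on f {x \<in> I. f x \<in> Inl ` J}}"

definition cid :: "'a set \<Rightarrow> 'a cmap" where
  "cid I = (\<lambda>x\<in>I. Inl x)"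

text \<open>\<open>ccomp I g f\<close> is the composite of \<open>g\<close> after \<open>f\<close>, where \<open>I\<close> is the domain of \<open>f\<close>.\<close>

definition ccomp :: "'a set \<Rightarrow> 'a cmap \<Rightarrow> 'a cmap \<Rightarrow> 'a cmap" where
  "ccomp I g f = (\<lambda>x\<in>I. case f x of Inl z \<Rightarrow> g z | Inr b \<Rightarrow> Inr b)"

text \<open>\<open>cells X I\<close> is $X_I$, and \<open>act X I J f\<close> is $X_f$ for a morphism \<open>f\<close> from \<open>I\<close> to \<open>J\<close>.\<close>

record ('a, 'x) cubical_data =
  cells :: "'a set \<Rightarrow> 'x set"
  act :: "'a set \<Rightarrow> 'a set \<Rightarrow> 'a cmap \<Rightarrow> 'x \<Rightarrow> 'x"

locale cubical_set =
  fixes X :: "('a, 'x) cubical_data"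
  assumes act_closed:
      "\<lbrakk>finite I; finite J; f \<in> cmor I J; x \<in> cells X I\<rbrakk> \<Longrightarrow> act X I J f x \<in> cells X J"
    and act_id:
      "\<lbrakk>finite I; x \<in> cells X I\<rbrakk> \<Longrightarrow> act X I I (cid I) x = x"
    and act_comp:
      "\<lbrakk>finite I; finite J; finite K; f \<in> cmor I J; g \<in> cmor J K; x \<in> cells X I\<rbrakk>
        \<Longrightarrow> act X I K (ccomp I g f) x = act X J K g (act X I J f x)"

definition cubical_hom ::
  "('a, 'x) cubical_data \<Rightarrow> ('a, 'z) cubical_data \<Rightarrow> ('a set \<Rightarrow> 'x \<Rightarrow> 'z) set" where
  "cubical_hom X Y =
    {\<eta> \<in> (\<Pi>\<^sub>E K\<in>{K. finite K}. cells X K \<rightarrow>\<^sub>E cells Y K).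
      \<forall>I J f x. finite I \<longrightarrow> finite J \<longrightarrow> f \<in> cmor I J \<longrightarrow> x \<in> cells X I \<longrightarrow>
        \<eta> J (act X I J f x) = act Y I J f (\<eta> I x)}"

definition cube :: "'a set \<Rightarrow> ('a, 'a cmap) cubical_data" where
  "cube L = \<lparr>cells = (\<lambda>K. cmor L K), act = (\<lambda>K K' h f. ccomp L h f)\<rparr>"

text \<open>
  The polymorphic face map sending \<open>i\<close> to \<open>b\<close> is represented by the pair \<open>(i, b)\<close>;
  for \<open>i \<notin> L\<close>, \<open>face L (i, b)\<close> is its instance from \<open>insert i L\<close> to \<open>L\<close>.
\<close>

type_synonym 'a pface = "'a \<times> endpoint"

definition face :: "'a set \<Rightarrow> 'a pface \<Rightarrow> 'a cmap" where
  "face L = (\<lambda>(i, b). \<lambda>x\<in>insert i L. if x = i then Inr b else Inl x)"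

datatype polarity = Pos | Neg

fun polarity_end :: "polarity \<Rightarrow> endpoint" where
  "polarity_end Pos = Zero"
| "polarity_end Neg = One"

definition faces :: "polarity \<Rightarrow> 'a set \<Rightarrow> 'a \<Rightarrow> 'a pface set" where
  "faces \<epsilon> I y = (I \<times> UNIV) \<union> {(y, polarity_end \<epsilon>)}"

text \<open>
  \<open>inst I J y f\<close> is the \<open>J\<close>-instance $f_J$, a morphism from \<open>I \<union> J \<union> {y}\<close> to
  \<open>inst_cod I J y f\<close>.
\<close>

definition inst_cod :: "'a set \<Rightarrow> 'a set \<Rightarrow> 'a \<Rightarrow> 'a pface \<Rightarrow> 'a set" where
  "inst_cod I J y f = ((I \<union> {y}) - {fst f}) \<union> J"

definition inst :: "'a set \<Rightarrow> 'a set \<Rightarrow> 'a \<Rightarrow> 'a pface \<Rightarrow> 'a cmap" where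
  "inst I J y f = face (inst_cod I J y f) f"

definition orthogonal :: "'a pface \<Rightarrow> 'a pface \<Rightarrow> bool" where
  "orthogonal f1 f2 \<longleftrightarrow> fst f1 \<noteq> fst f2"

lemma orthogonal_commute:
  assumes "orthogonal f1 f2" "fst f1 \<in> L" "fst f2 \<in> L"
  defines "M \<equiv> L - {fst f1, fst f2}"
  shows "ccomp L (face M f2) (face (L - {fst f1}) f1)
       = ccomp L (face M f1) (face (L - {fst f2}) f2)"
  using assms
  by (auto simp: ccomp_def face_def orthogonal_def fun_eq_iff split: prod.splits)

definition factorization ::
  "polarity \<Rightarrow> 'a set \<Rightarrow> 'a set \<Rightarrow> 'a \<Rightarrow> 'a set \<Rightarrow> 'a cmap \<Rightarrow> 'a pface \<Rightarrow> 'a cmap \<Rightarrow> bool" where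
  "factorization \<epsilon> I J y K f g h \<longleftrightarrow>
    g \<in> faces \<epsilon> I y \<and> h \<in> cmor (inst_cod I J y g) K \<and>
    f = ccomp (I \<union> J \<union> {y}) h (inst I J y g)"

definition free_box ::
  "polarity \<Rightarrow> 'a set \<Rightarrow> 'a set \<Rightarrow> 'a \<Rightarrow> ('a, 'a cmap) cubical_data" where
  "free_box \<epsilon> I J y =
    \<lparr>cells = (\<lambda>K. {f \<in> cells (cube (I \<union> J \<union> {y})) K. \<exists>g h. factorization \<epsilon> I J y K f g h}),
     act = act (cube (I \<union> J \<union> {y}))\<rparr>"

text \<open>
  In the adjacency condition, the instance of \<open>f2\<close> starts at the codomain of the instance
  of \<open>f1\<close>, hence ends at that set with the symbol of \<open>f2\<close> removed.
\<close>

definition alg_box ::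
  "polarity \<Rightarrow> ('a, 'x) cubical_data \<Rightarrow> 'a set \<Rightarrow> 'a set \<Rightarrow> 'a \<Rightarrow> ('a pface \<Rightarrow> 'x) set" where
  "alg_box \<epsilon> X I J y =
    {b \<in> (\<Pi>\<^sub>E f\<in>faces \<epsilon> I y. cells X (inst_cod I J y f)).
      \<forall>f1\<in>faces \<epsilon> I y. \<forall>f2\<in>faces \<epsilon> I y. orthogonal f1 f2 \<longrightarrow>
        (let L1 = inst_cod I J y f1; M1 = L1 - {fst f2};
             L2 = inst_cod I J y f2; M2 = L2 - {fst f1}
         in act X L1 M1 (face M1 f2) (b f1) = act X L2 M2 (face M2 f1) (b f2))}"

definition nrv ::
  "polarity \<Rightarrow> 'a set \<Rightarrow> 'a set \<Rightarrow> 'a \<Rightarrow> ('a set \<Rightarrow> 'a cmap \<Rightarrow> 'x) \<Rightarrow> 'a pface \<Rightarrow> 'x" where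
  "nrv \<epsilon> I J y \<beta> = (\<lambda>f\<in>faces \<epsilon> I y. \<beta> (inst_cod I J y f) (inst I J y f))"

definition rlz ::
  "polarity \<Rightarrow> ('a, 'x) cubical_data \<Rightarrow> 'a set \<Rightarrow> 'a set \<Rightarrow> 'a \<Rightarrow>
    ('a pface \<Rightarrow> 'x) \<Rightarrow> 'a set \<Rightarrow> 'a cmap \<Rightarrow> 'x" where
  "rlz \<epsilon> X I J y b =
    (\<lambda>K\<in>{K. finite K}. \<lambda>f\<in>cells (free_box \<epsilon> I J y) K.
      let (f1, f2) = (SOME (f1, f2). factorization \<epsilon> I J y K f f1 f2)
      in act X (inst_cod I J y f1) K f2 (b f1))"

end

theory Submission
  imports Defs
begin

text \<open>
  A map factors through the face map sending \<open>i\<close> to \<open>b\<close> exactly when it sends \<open>i\<close> to \<open>b\<close>, and the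
  other factor is then forced to be its restriction away from \<open>i\<close>. Hence the only freedom in
  factoring a cell of the box is the choice of the face. Two different faces involve different
  symbols (a map has one value at each symbol), so the cell factors through the composite of the
  two, and adjacency makes the realization independent of the choice. After that, one inverse law is naturality
  and the other is preservation of identities.
\<close>

section \<open>Calculus of the cube category: composition, restriction, faces\<close>

lemma cmor_iff:
  "f \<in> cmor I J \<longleftrightarrow>
    f \<in> extensional I \<and>
    (\<forall>x\<in>I. \<forall>z. f x = Inl z \<longrightarrow> z \<in> J) \<and>
    (\<forall>x\<in>I. \<forall>x'\<in>I. \<forall>z. f x = Inl z \<longrightarrow> f x' = Inl z \<longrightarrow> x = x')"
proof -
  \<comment> \<open>Endpoints always lie in the disjoint sum, so the codomain condition only
    concerns \<open>Inl\<close> values.\<close>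
  have "f x \<in> J <+> (UNIV :: endpoint set) \<longleftrightarrow> (\<forall>z. f x = Inl z \<longrightarrow> z \<in> J)" for x
    by (cases "f x") auto
  then show ?thesis
    unfolding cmor_def PiE_def Pi_def inj_on_def by (auto; metis)
qed

lemma ccomp_in_cmor:
  assumes "f \<in> cmor I J" "g \<in> cmor J K"
  shows "ccomp I g f \<in> cmor I K"
proof -
  \<comment> \<open>A symbol value of the composite arises from a symbol value of \<open>f\<close>
    followed by one of \<open>g\<close>, so injectivity passes back through \<open>g\<close> and
    then \<open>f\<close>.\<close>
  have "(\<exists>w. f x = Inl w \<and> w \<in> J \<and> g w = Inl z)" if "x \<in> I" "ccomp I g f x = Inl z" for x z
    using that assms(1) by (auto simp: ccomp_def cmor_iff split: sum.splits)
  moreover have "ccomp I g f \<in> extensional I"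
    by (simp add: ccomp_def)
  ultimately show ?thesis
    using assms unfolding cmor_iff by metis
qed

lemma face_in_cmor: "face L (i, b) \<in> cmor (insert i L) L"
  by (auto simp: cmor_iff face_def split: if_splits)

lemma restrict_in_cmor:
  assumes "f \<in> cmor L K" "M \<subseteq> L"
  shows "restrict f M \<in> cmor M K"
  unfolding cmor_iff
proof (intro conjI ballI allI impI)
  fix x x' z assume "x \<in> M" "x' \<in> M" "restrict f M x = Inl z" "restrict f M x' = Inl z"
  then show "x = x'"
    using assms unfolding cmor_iff by (metis restrict_apply' subsetD)
qed (use assms in \<open>auto simp: cmor_iff\<close>)

text \<open>The face fixes each symbol of \<open>L\<close> other than \<open>i\<close> and
  contributes the endpoint \<open>b\<close> at \<open>i\<close>, where \<open>f\<close> already has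
  it. This is the existence half of the factorization criterion.\<close>

lemma ccomp_restrict_face:
  assumes "f \<in> extensional (insert i L)" "f i = Inr b"
  shows "ccomp (insert i L) (restrict f L) (face L (i, b)) = f"
  using assms by (auto simp: ccomp_def face_def fun_eq_iff extensional_def)

text \<open>Uniqueness half: on \<open>L\<close> the face is the inclusion, so \<open>h\<close> can
  be read off from the composite. Were \<open>i\<close> in \<open>L\<close>, the face would hide the
  value of \<open>h\<close> there.\<close>

lemma restrict_ccomp_face:
  assumes "h \<in> extensional L" "i \<notin> L"
  shows "restrict (ccomp (insert i L) h (face L (i, b))) L = h"
  using assms by (auto simp: ccomp_def face_def fun_eq_iff extensional_def)

lemma restrict_face: "i \<notin> L \<Longrightarrow> restrict (face L (i, b)) L = cid L"
  by (auto simp: face_def cid_def fun_eq_iff)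

text \<open>Post-composition acts value by value. For naturality of the realization, this says that
  the complementary factor of a composite is the composite of the complementary factor.\<close>

lemma restrict_ccomp: "M \<subseteq> L \<Longrightarrow> restrict (ccomp L h f) M = ccomp M h (restrict f M)"
  by (auto simp: ccomp_def fun_eq_iff)

lemma ccomp_Inr: "x \<in> I \<Longrightarrow> f x = Inr b \<Longrightarrow> ccomp I g f x = Inr b"
  by (simp add: ccomp_def)

text \<open>Morphisms are extensional in two layers, undefined off the finite sets and off the
  cells, so \<open>PiE_ext\<close> is applied once per layer.\<close>

lemma cubical_hom_eqI:
  assumes "\<eta> \<in> cubical_hom X Y" "\<theta> \<in> cubical_hom X Y"
    and "\<And>K x. finite K \<Longrightarrow> x \<in> cells X K \<Longrightarrow> \<eta> K x = \<theta> K x"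
  shows "\<eta> = \<theta>"
proof -
  have mem: "\<eta> \<in> (\<Pi>\<^sub>E K\<in>{K. finite K}. cells X K \<rightarrow>\<^sub>E cells Y K)"
    "\<theta> \<in> (\<Pi>\<^sub>E K\<in>{K. finite K}. cells X K \<rightarrow>\<^sub>E cells Y K)"
    using assms(1,2) by (simp_all add: cubical_hom_def)
  show ?thesis
  proof (rule PiE_ext[OF mem])
    fix K :: "'a set" assume K: "K \<in> {K. finite K}"
    show "\<eta> K = \<theta> K"
      by (rule PiE_ext[OF PiE_mem[OF mem(1) K] PiE_mem[OF mem(2) K]]) (use assms(3) K in simp)
  qed
qed

section \<open>Faces, factorizations and cells of the free-standing box\<close>

locale box_shape =
  fixes \<epsilon> :: polarity and I J :: "'a set" and y :: 'a
  assumes finI: "finite I" and finJ: "finite J" and disj: "I \<inter> J = {}" and yIJ: "y \<notin> I \<union> J"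
begin

abbreviation L :: "'a set" where "L \<equiv> I \<union> J \<union> {y}"

lemma finite_L: "finite L"
  using finI finJ by simp

lemma fst_in_L: "g \<in> faces \<epsilon> I y \<Longrightarrow> fst g \<in> L"
  by (auto simp: faces_def)

text \<open>Face symbols lie in \<open>I\<close> or equal \<open>y\<close>, hence lie outside
  \<open>J\<close>; removing one before or after adjoining \<open>J\<close> gives the same
  set.\<close>

lemma inst_cod_eq: "g \<in> faces \<epsilon> I y \<Longrightarrow> inst_cod I J y g = L - {fst g}"
  using disj yIJ by (auto simp: faces_def inst_cod_def)

lemma inst_eq: "g \<in> faces \<epsilon> I y \<Longrightarrow> inst I J y g = face (L - {fst g}) (fst g, snd g)"
  by (simp add: inst_def inst_cod_eq)

lemma insert_L: "g \<in> faces \<epsilon> I y \<Longrightarrow> insert (fst g) (L - {fst g}) = L"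
  using fst_in_L by blast

lemma inst_in_cmor: "g \<in> faces \<epsilon> I y \<Longrightarrow> inst I J y g \<in> cmor L (L - {fst g})"
  using face_in_cmor[of "L - {fst g}" "fst g" "snd g"] by (simp only: inst_eq insert_L)

lemma inst_fst: "g \<in> faces \<epsilon> I y \<Longrightarrow> inst I J y g (fst g) = Inr (snd g)"
  by (simp add: inst_def face_def case_prod_beta)

lemma ccomp_restrict_inst:
  assumes "g \<in> faces \<epsilon> I y" "f \<in> cmor L K" "f (fst g) = Inr (snd g)"
  shows "ccomp L (restrict f (L - {fst g})) (inst I J y g) = f"
  using ccomp_restrict_face[of f "fst g" "L - {fst g}" "snd g"] assms
  by (simp only: inst_eq insert_L cmor_iff)

lemma factorization_iff:
  assumes "f \<in> cmor L K"
  shows "factorization \<epsilon> I J y K f g h \<longleftrightarrow>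
    g \<in> faces \<epsilon> I y \<and> f (fst g) = Inr (snd g) \<and> h = restrict f (L - {fst g})"
    (is "?lhs \<longleftrightarrow> ?rhs")
proof
  assume ?lhs
  then have g: "g \<in> faces \<epsilon> I y" and h: "h \<in> cmor (L - {fst g}) K"
    and f: "f = ccomp L h (inst I J y g)"
    by (auto simp: factorization_def inst_cod_eq)
  have "f (fst g) = Inr (snd g)"
    unfolding f using fst_in_L[OF g] inst_fst[OF g] by (rule ccomp_Inr)
  moreover have "restrict (ccomp L h (inst I J y g)) (L - {fst g}) = h"
    using restrict_ccomp_face[of h "L - {fst g}" "fst g" "snd g"] h
    unfolding inst_eq[OF g] insert_L[OF g] cmor_iff by blast
  then have "h = restrict f (L - {fst g})"
    unfolding f by (rule sym)
  ultimately show ?rhs using g by simp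
next
  assume ?rhs
  then show ?lhs
    using ccomp_restrict_inst[OF _ assms, of g] restrict_in_cmor[OF assms, of "L - {fst g}"]
    by (auto simp: factorization_def inst_cod_eq)
qed

lemma free_box_cells:
  "f \<in> cells (free_box \<epsilon> I J y) K \<longleftrightarrow>
    f \<in> cmor L K \<and> (\<exists>g\<in>faces \<epsilon> I y. f (fst g) = Inr (snd g))"
  \<comment> \<open>The bound face stays a single variable instead of being split into a pair, so
    that \<open>fst g\<close> and \<open>snd g\<close> match
    \<open>factorization_iff\<close>.\<close>
  using factorization_iff[of f K] unfolding free_box_def cube_def by (simp del: split_paired_Ex) blast

lemma free_box_act: "act (free_box \<epsilon> I J y) K K' h f = ccomp L h f"
  by (simp add: free_box_def cube_def)

lemma inst_in_free_box:
  "g \<in> faces \<epsilon> I y \<Longrightarrow> inst I J y g \<in> cells (free_box \<epsilon> I J y) (L - {fst g})"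
  using inst_in_cmor inst_fst unfolding free_box_cells by blast

text \<open>Endpoint values survive post-composition, so the face witnessing \<open>f\<close> also
  witnesses the composite.\<close>

lemma ccomp_in_free_box:
  assumes "f \<in> cells (free_box \<epsilon> I J y) K" "h \<in> cmor K K'"
  shows "ccomp L h f \<in> cells (free_box \<epsilon> I J y) K'"
proof -
  obtain g where g: "g \<in> faces \<epsilon> I y" "f (fst g) = Inr (snd g)" and f: "f \<in> cmor L K"
    using assms(1) by (auto simp: free_box_cells)
  have "ccomp L h f (fst g) = Inr (snd g)"
    using fst_in_L[OF g(1)] g(2) by (rule ccomp_Inr)
  then show ?thesis
    using g(1) ccomp_in_cmor[OF f assms(2)] by (auto simp: free_box_cells)
qed

lemma second_face_in_cmor:
  assumes "g1 \<in> faces \<epsilon> I y" "g2 \<in> faces \<epsilon> I y" "fst g1 \<noteq> fst g2"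
  shows "face (L - {fst g1, fst g2}) g2 \<in> cmor (L - {fst g1}) (L - {fst g1, fst g2})"
proof -
  have "insert (fst g2) (L - {fst g1, fst g2}) = L - {fst g1}"
    using assms(3) fst_in_L[OF assms(2)] by blast
  then show ?thesis
    using face_in_cmor[of "L - {fst g1, fst g2}" "fst g2" "snd g2"] by simp
qed

text \<open>The symbol of \<open>g2\<close> survives the removal of that of \<open>g1\<close>, so
  the restriction still takes an endpoint there and can be factored through a face a second
  time.\<close>

lemma restrict_through_second_face:
  assumes "f \<in> cmor L K" "g1 \<in> faces \<epsilon> I y" "g2 \<in> faces \<epsilon> I y" "fst g1 \<noteq> fst g2"
    and "f (fst g2) = Inr (snd g2)"
  shows "restrict f (L - {fst g1}) =
    ccomp (L - {fst g1}) (restrict f (L - {fst g1, fst g2})) (face (L - {fst g1, fst g2}) g2)"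
proof -
  have M: "insert (fst g2) (L - {fst g1, fst g2}) = L - {fst g1}"
    using assms(4) fst_in_L[OF assms(3)] by blast
  have "restrict (restrict f (L - {fst g1})) (L - {fst g1, fst g2}) = restrict f (L - {fst g1, fst g2})"
    by (auto simp: fun_eq_iff)
  moreover have "restrict f (L - {fst g1}) (fst g2) = Inr (snd g2)"
    using assms(4,5) fst_in_L[OF assms(3)] by simp
  ultimately show ?thesis
    using ccomp_restrict_face[of "restrict f (L - {fst g1})" "fst g2" "L - {fst g1, fst g2}" "snd g2"]
    unfolding M by simp
qed

section \<open>Algebraic boxes and the nerve\<close>

lemma alg_box_iff:
  "b \<in> alg_box \<epsilon> X I J y \<longleftrightarrow>
    b \<in> extensional (faces \<epsilon> I y) \<and>
    (\<forall>g\<in>faces \<epsilon> I y. b g \<in> cells X (L - {fst g})) \<and>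
    (\<forall>g1\<in>faces \<epsilon> I y. \<forall>g2\<in>faces \<epsilon> I y. fst g1 \<noteq> fst g2 \<longrightarrow>
      act X (L - {fst g1}) (L - {fst g1, fst g2}) (face (L - {fst g1, fst g2}) g2) (b g1) =
      act X (L - {fst g2}) (L - {fst g1, fst g2}) (face (L - {fst g1, fst g2}) g1) (b g2))"
proof -
  \<comment> \<open>Iterated removals get one symmetric form, so that both sides of adjacency
    visibly end in the same set.\<close>
  have "L - {i} - {j} = L - {i, j}" "L - {j} - {i} = L - {i, j}" for i j
    by auto
  then show ?thesis
    by (simp add: alg_box_def PiE_def Pi_def Ball_def[symmetric] Let_def inst_cod_eq orthogonal_def
        conj_ac del: split_paired_All)
qed

lemma hom_in_cells:
  assumes "\<beta> \<in> cubical_hom (free_box \<epsilon> I J y) X" "finite K" "f \<in> cells (free_box \<epsilon> I J y) K"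
  shows "\<beta> K f \<in> cells X K"
proof -
  have "\<beta> \<in> (\<Pi>\<^sub>E K\<in>{K. finite K}. cells (free_box \<epsilon> I J y) K \<rightarrow>\<^sub>E cells X K)"
    using assms(1) by (simp add: cubical_hom_def)
  from PiE_mem[OF PiE_mem[OF this]] show ?thesis
    using assms(2,3) by blast
qed

lemma hom_ccomp:
  assumes "\<beta> \<in> cubical_hom (free_box \<epsilon> I J y) X" "finite K" "finite K'"
    "h \<in> cmor K K'" "f \<in> cells (free_box \<epsilon> I J y) K"
  shows "\<beta> K' (ccomp L h f) = act X K K' h (\<beta> K f)"
  using assms by (simp add: cubical_hom_def free_box_act)

lemma nrv_eq: "g \<in> faces \<epsilon> I y \<Longrightarrow> nrv \<epsilon> I J y \<beta> g = \<beta> (L - {fst g}) (inst I J y g)"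
  by (simp add: nrv_def inst_cod_eq)

text \<open>Naturality turns each side of adjacency into the value of \<open>\<beta>\<close> on a
  composite of two face maps, and \<open>orthogonal_commute\<close> identifies the
  composites.\<close>

lemma nrv_in_alg_box:
  assumes \<beta>: "\<beta> \<in> cubical_hom (free_box \<epsilon> I J y) X"
  shows "nrv \<epsilon> I J y \<beta> \<in> alg_box \<epsilon> X I J y"
  unfolding alg_box_iff
proof (intro conjI ballI impI)
  show "nrv \<epsilon> I J y \<beta> \<in> extensional (faces \<epsilon> I y)"
    by (simp add: nrv_def)
next
  fix g assume "g \<in> faces \<epsilon> I y"
  then show "nrv \<epsilon> I J y \<beta> g \<in> cells X (L - {fst g})"
    using hom_in_cells[OF \<beta> _ inst_in_free_box] finite_L by (simp add: nrv_eq)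
next
  fix g1 g2
  assume g1: "g1 \<in> faces \<epsilon> I y" and g2: "g2 \<in> faces \<epsilon> I y" and ne: "fst g1 \<noteq> fst g2"
  let ?M = "L - {fst g1, fst g2}"
  have fin: "finite (L - A)" for A
    using finite_L by blast
  have "act X (L - {fst g1}) ?M (face ?M g2) (nrv \<epsilon> I J y \<beta> g1)
      = \<beta> ?M (ccomp L (face ?M g2) (inst I J y g1))"
    unfolding nrv_eq[OF g1]
    by (rule hom_ccomp[symmetric, OF \<beta> fin fin second_face_in_cmor[OF g1 g2 ne] inst_in_free_box[OF g1]])
  also have "ccomp L (face ?M g2) (inst I J y g1) = ccomp L (face ?M g1) (inst I J y g2)"
    using orthogonal_commute[of g1 g2 L] ne fst_in_L[OF g1] fst_in_L[OF g2]
    unfolding inst_eq[OF g1] inst_eq[OF g2] orthogonal_def prod.collapse by blast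
  \<comment> \<open>With the roles exchanged, naturality ends at
    \<open>L - {fst g2, fst g1}\<close>; \<open>insert_commute\<close> identifies this with
    \<open>?M\<close>.\<close>
  also have "\<beta> ?M \<dots> = act X (L - {fst g2}) ?M (face ?M g1) (nrv \<epsilon> I J y \<beta> g2)"
    unfolding nrv_eq[OF g2]
    using hom_ccomp[OF \<beta> fin fin second_face_in_cmor[OF g2 g1 ne[symmetric]] inst_in_free_box[OF g2]]
    by (simp only: insert_commute)
  finally show "act X (L - {fst g1}) ?M (face ?M g2) (nrv \<epsilon> I J y \<beta> g1)
      = act X (L - {fst g2}) ?M (face ?M g1) (nrv \<epsilon> I J y \<beta> g2)" .
qed

end

section \<open>Realization and its independence of the factorization\<close>

locale box_in_cubical_set = box_shape \<epsilon> I J y + cubical_set X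
  for \<epsilon> :: polarity and I J :: "'a set" and y :: 'a and X :: "('a, 'x) cubical_data"
begin

text \<open>Functoriality applied to the two-step factorization. The inner action is now one side of
  adjacency, which allows \<open>g1\<close> to be exchanged for \<open>g2\<close>.\<close>

lemma act_restrict_via_second_face:
  assumes "b \<in> alg_box \<epsilon> X I J y" "finite K" "f \<in> cmor L K"
    and g1: "g1 \<in> faces \<epsilon> I y" and g2: "g2 \<in> faces \<epsilon> I y" "fst g1 \<noteq> fst g2"
    and "f (fst g2) = Inr (snd g2)"
  shows "act X (L - {fst g1}) K (restrict f (L - {fst g1})) (b g1) =
    act X (L - {fst g1, fst g2}) K (restrict f (L - {fst g1, fst g2}))
      (act X (L - {fst g1}) (L - {fst g1, fst g2}) (face (L - {fst g1, fst g2}) g2) (b g1))"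
proof -
  have fin: "finite (L - A)" for A
    using finite_L by blast
  have "b g1 \<in> cells X (L - {fst g1})"
    using assms(1) g1 by (simp add: alg_box_iff)
  then show ?thesis
    unfolding restrict_through_second_face[OF assms(3) g1 g2 assms(7)]
    by (intro act_comp[OF fin fin assms(2) second_face_in_cmor[OF g1 g2]]
        restrict_in_cmor[OF assms(3)]) auto
qed

lemma act_restrict_unique:
  assumes b: "b \<in> alg_box \<epsilon> X I J y" and K: "finite K" and f: "f \<in> cmor L K"
    and g1: "g1 \<in> faces \<epsilon> I y" "f (fst g1) = Inr (snd g1)"
    and g2: "g2 \<in> faces \<epsilon> I y" "f (fst g2) = Inr (snd g2)"
  shows "act X (L - {fst g1}) K (restrict f (L - {fst g1})) (b g1) =
    act X (L - {fst g2}) K (restrict f (L - {fst g2})) (b g2)"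
proof (cases "fst g1 = fst g2")
  case True
  \<comment> \<open>The map \<open>f\<close> has one value at the common symbol, so the endpoints
    agree as well.\<close>
  with g1(2) g2(2) have "g1 = g2"
    by (simp add: prod_eq_iff)
  then show ?thesis by simp
next
  case False
  let ?M = "L - {fst g1, fst g2}"
  have "act X (L - {fst g1}) ?M (face ?M g2) (b g1) = act X (L - {fst g2}) ?M (face ?M g1) (b g2)"
    using b g1(1) g2(1) False unfolding alg_box_iff by blast
  then show ?thesis
    using act_restrict_via_second_face[OF b K f g1(1) g2(1) False g2(2)]
      act_restrict_via_second_face[OF b K f g2(1) g1(1) False[symmetric] g1(2)]
    by (simp only: insert_commute)
qed

text \<open>Eliminates the choice in \<open>rlz\<close>: \<open>act_restrict_unique\<close> lets the
  chosen face be replaced by any admissible \<open>g\<close>.\<close>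

lemma rlz_eq:
  assumes b: "b \<in> alg_box \<epsilon> X I J y" and K: "finite K" and f: "f \<in> cmor L K"
    and g: "g \<in> faces \<epsilon> I y" "f (fst g) = Inr (snd g)"
  shows "rlz \<epsilon> X I J y b K f = act X (L - {fst g}) K (restrict f (L - {fst g})) (b g)"
proof -
  define p where "p = (SOME (f1, f2). factorization \<epsilon> I J y K f f1 f2)"
  \<comment> \<open>The given \<open>g\<close> shows that some factorization exists, so
    \<open>p\<close> is one too, though possibly with another face.\<close>
  have "case p of (f1, f2) \<Rightarrow> factorization \<epsilon> I J y K f f1 f2"
    unfolding p_def
  proof (rule someI)
    show "case (g, restrict f (L - {fst g})) of (f1, f2) \<Rightarrow> factorization \<epsilon> I J y K f f1 f2"
      using g by (simp only: factorization_iff[OF f] prod.case simp_thms)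
  qed
  then have p: "fst p \<in> faces \<epsilon> I y" "f (fst (fst p)) = Inr (snd (fst p))"
    "snd p = restrict f (L - {fst (fst p)})"
    unfolding case_prod_beta factorization_iff[OF f] by blast+
  have "f \<in> cells (free_box \<epsilon> I J y) K"
    using f g unfolding free_box_cells by blast
  then have "rlz \<epsilon> X I J y b K f = act X (inst_cod I J y (fst p)) K (snd p) (b (fst p))"
    using K by (simp add: rlz_def p_def case_prod_beta)
  then show ?thesis
    using act_restrict_unique[OF b K f p(1,2) g] p(3) inst_cod_eq[OF p(1)] by simp
qed

lemma rlz_in_hom:
  assumes b: "b \<in> alg_box \<epsilon> X I J y"
  shows "rlz \<epsilon> X I J y b \<in> cubical_hom (free_box \<epsilon> I J y) X"
proof -
  have fin: "finite (L - A)" for A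
    using finite_L by blast
  have bg: "b g \<in> cells X (L - {fst g})" if "g \<in> faces \<epsilon> I y" for g
    using b that by (simp add: alg_box_iff)
  have closed: "rlz \<epsilon> X I J y b K f \<in> cells X K"
    if K: "finite K" and f: "f \<in> cells (free_box \<epsilon> I J y) K" for K f
  proof -
    obtain g where f': "f \<in> cmor L K" and g: "g \<in> faces \<epsilon> I y" "f (fst g) = Inr (snd g)"
      using f by (auto simp: free_box_cells)
    have "restrict f (L - {fst g}) \<in> cmor (L - {fst g}) K"
      by (rule restrict_in_cmor[OF f']) blast
    then show ?thesis
      unfolding rlz_eq[OF b K f' g] by (rule act_closed[OF fin K _ bg[OF g(1)]])
  qed
  have natural: "rlz \<epsilon> X I J y b K' (ccomp L h f) = act X K K' h (rlz \<epsilon> X I J y b K f)"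
    if K: "finite K" "finite K'" and h: "h \<in> cmor K K'" and f: "f \<in> cells (free_box \<epsilon> I J y) K"
    for K K' h f
  proof -
    obtain g where f': "f \<in> cmor L K" and g: "g \<in> faces \<epsilon> I y" "f (fst g) = Inr (snd g)"
      using f by (auto simp: free_box_cells)
    have r: "restrict f (L - {fst g}) \<in> cmor (L - {fst g}) K"
      by (rule restrict_in_cmor[OF f']) blast
    \<comment> \<open>The composite has the same endpoint as \<open>f\<close> at the symbol of
      \<open>g\<close>, so the same face evaluates both cells and naturality becomes
      \<open>act_comp\<close>.\<close>
    have "rlz \<epsilon> X I J y b K' (ccomp L h f)
        = act X (L - {fst g}) K' (restrict (ccomp L h f) (L - {fst g})) (b g)"
        using fst_in_L[OF g(1)] g(2) by (intro rlz_eq[OF b K(2) ccomp_in_cmor[OF f' h] g(1)] ccomp_Inr)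
    also have "restrict (ccomp L h f) (L - {fst g}) = ccomp (L - {fst g}) h (restrict f (L - {fst g}))"
      by (rule restrict_ccomp) blast
    also have "act X (L - {fst g}) K' \<dots> (b g)
        = act X K K' h (act X (L - {fst g}) K (restrict f (L - {fst g})) (b g))"
      by (rule act_comp[OF fin K r h bg[OF g(1)]])
    finally show ?thesis
      unfolding rlz_eq[OF b K(1) f' g] .
  qed
  \<comment> \<open>The two restricted abstractions in \<open>rlz\<close> supply the default
    \<open>undefined\<close> required by the two nested extensional products.\<close>
  have "rlz \<epsilon> X I J y b \<in>
      (\<Pi>\<^sub>E K\<in>{K. finite K}. cells (free_box \<epsilon> I J y) K \<rightarrow>\<^sub>E cells X K)"
  proof (intro PiE_I)
    fix K f assume "K \<in> {K. finite K}" "f \<notin> cells (free_box \<epsilon> I J y) K"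
    then show "rlz \<epsilon> X I J y b K f = undefined"
      by (simp add: rlz_def)
  next
    fix K :: "'a set" assume "K \<notin> {K. finite K}"
    then show "rlz \<epsilon> X I J y b K = undefined"
      by (simp add: rlz_def)
  qed (simp add: closed)
  then show ?thesis
    using natural by (simp add: cubical_hom_def free_box_act)
qed

section \<open>The two inverse laws\<close>

lemma rlz_nrv:
  assumes \<beta>: "\<beta> \<in> cubical_hom (free_box \<epsilon> I J y) X"
  shows "rlz \<epsilon> X I J y (nrv \<epsilon> I J y \<beta>) = \<beta>"
proof -
  let ?b = "nrv \<epsilon> I J y \<beta>"
  have b: "?b \<in> alg_box \<epsilon> X I J y"
    using \<beta> by (rule nrv_in_alg_box)
  show ?thesis
  proof (rule cubical_hom_eqI[OF rlz_in_hom[OF b] \<beta>])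
    fix K f assume K: "finite K" and "f \<in> cells (free_box \<epsilon> I J y) K"
    then obtain g where f: "f \<in> cmor L K" and g: "g \<in> faces \<epsilon> I y" "f (fst g) = Inr (snd g)"
      by (auto simp: free_box_cells)
    have r: "restrict f (L - {fst g}) \<in> cmor (L - {fst g}) K"
      by (rule restrict_in_cmor[OF f]) blast
    have fin: "finite (L - {fst g})"
      using finite_L by blast
    have "rlz \<epsilon> X I J y ?b K f
        = act X (L - {fst g}) K (restrict f (L - {fst g})) (\<beta> (L - {fst g}) (inst I J y g))"
      unfolding rlz_eq[OF b K f g] nrv_eq[OF g(1)] ..
    \<comment> \<open>Naturality of \<open>\<beta>\<close> along the restriction, whose composite
      with the instance of \<open>g\<close> rebuilds \<open>f\<close>.\<close>
    also have "\<dots> = \<beta> K (ccomp L (restrict f (L - {fst g})) (inst I J y g))"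
      by (rule hom_ccomp[symmetric, OF \<beta> fin K r inst_in_free_box[OF g(1)]])
    also have "\<dots> = \<beta> K f"
      unfolding ccomp_restrict_inst[OF g(1) f g(2)] ..
    finally show "rlz \<epsilon> X I J y ?b K f = \<beta> K f" .
  qed
qed

text \<open>The instance of \<open>g\<close> is a box cell with the required endpoint at the symbol
  of \<open>g\<close>, so \<open>rlz_eq\<close> may evaluate it at \<open>g\<close> itself; the
  complementary factor is then an identity. Off the faces both families are
  \<open>undefined\<close>.\<close>

lemma nrv_rlz:
  assumes b: "b \<in> alg_box \<epsilon> X I J y"
  shows "nrv \<epsilon> I J y (rlz \<epsilon> X I J y b) = b"
proof (rule extensionalityI[where A = "faces \<epsilon> I y"])
  show "b \<in> extensional (faces \<epsilon> I y)"
    using b by (simp add: alg_box_iff)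
next
  fix g assume g: "g \<in> faces \<epsilon> I y"
  have fin: "finite (L - {fst g})"
    using finite_L by blast
  have "nrv \<epsilon> I J y (rlz \<epsilon> X I J y b) g
      = act X (L - {fst g}) (L - {fst g}) (restrict (inst I J y g) (L - {fst g})) (b g)"
    unfolding nrv_eq[OF g] by (rule rlz_eq[OF b fin inst_in_cmor[OF g] g inst_fst[OF g]])
  also have "restrict (inst I J y g) (L - {fst g}) = cid (L - {fst g})"
    unfolding inst_eq[OF g] by (rule restrict_face) simp
  also have "act X (L - {fst g}) (L - {fst g}) \<dots> (b g) = b g"
    using b g by (intro act_id fin) (simp add: alg_box_iff)
  finally show "nrv \<epsilon> I J y (rlz \<epsilon> X I J y b) g = b g" .
qed (simp add: nrv_def)

end

theorem proposition3:
  fixes X :: "('a, 'x) cubical_data" and I J :: "'a set" and y :: 'a and \<epsilon> :: polarity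
  assumes "infinite (UNIV :: 'a set)"
    and "cubical_set X"
    and "finite I" and "finite J" and "I \<inter> J = {}" and "y \<notin> I \<union> J"
  shows "nrv \<epsilon> I J y \<in> cubical_hom (free_box \<epsilon> I J y) X \<rightarrow> alg_box \<epsilon> X I J y
    \<and> rlz \<epsilon> X I J y \<in> alg_box \<epsilon> X I J y \<rightarrow> cubical_hom (free_box \<epsilon> I J y) X
    \<and> (\<forall>\<beta> \<in> cubical_hom (free_box \<epsilon> I J y) X. rlz \<epsilon> X I J y (nrv \<epsilon> I J y \<beta>) = \<beta>)
    \<and> (\<forall>b \<in> alg_box \<epsilon> X I J y. nrv \<epsilon> I J y (rlz \<epsilon> X I J y b) = b)"
proof -
  interpret cubical_set X by fact
  interpret box_in_cubical_set \<epsilon> I J y X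
    using assms by unfold_locales
  show ?thesis
    using nrv_in_alg_box rlz_in_hom rlz_nrv nrv_rlz by blast
qed

end
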